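(* Let $I,T,S,H$ be nonempty finite sets. For all $i\in I$ and $h\in H$ let $w_{i0}>0$ and $w_{ih}>0$ be real numbers, and for all $i\in I$, $h\in H$, $t\in T$, $s\in S$ let $d^{ts}_{ih}\ge 0$ be real numbers. Put $\overline{d}^{ts}_i := \max_{h\in H}\{d^{ts}_{ih}\}$. For fixed $i\in I$, $t\in T$, $s\in S$, define $Q^{ts}_i:[0,1]^{|H|}\to\mathbb{R}$ by $$Q^{ts}_i(x^{ts}) = \sum_{h\in H} w_{ih}\left(\frac{\overline{d}^{ts}_i x^{ts}_h - \big(\overline{d}^{ts}_i - d^{ts}_{ih}\big)\big(x^{ts}_h\big)^2}{w_{i0}+\sum_{h'\in H} w_{ih'}x^{ts}_{h'}}\right).$$ Then: (1) $Q^{ts}_i$ is concave over $[0,1]^{|H|}$. (2) For every binary vector $x^{ts}\in\{0,1\}^{|H|}$ and every $q^{ts}_i\in\mathbb{R}$, the inequality $$q^{ts}_i \le \sum_{h\in H} \frac{d^{ts}_{ih}w_{ih}x^{ts}_h}{w_{i0}+\sum_{h'\in H} w_{ih'}x^{ts}_{h'}}$$ holds if and only if $$q^{ts}_i \le Q^{ts}_i(\hat{x}^{ts}) + \sum_{h\in H}\left(\frac{\partial Q^{ts}_i}{\partial \hat{x}^{ts}_h}\right)\big(x^{ts}_h-\hat{x}^{ts}_h\big)\quad\text{for all } \hat{x}^{ts}\in\{0,1\}^{|H|},$$ where $\partial Q^{ts}_i/\partial \hat{x}^{ts}_h$ denotes the partial derivative of $Q^{ts}_i$ with respect to its $h$-th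 coordinate, evaluated at $\hat{x}^{ts}$.
   Context: In the underlying model, $I$ is the set of demand nodes, $T$ the set of time periods, $S$ the set of scenarios, and $H=J\times K$ the set of pairs (candidate location $j$, station type $k$). The weights are $w_{ih}=\exp(\alpha_{ijk}+\beta s_{ij})$ for $h=(j,k)$ and $w_{i0}=\exp(\alpha_{i0})$, hence positive. The coefficients are $d^{ts}_{ih}=r_k d^{ts}_i$ for $h=(j,k)$, where $r_k$ is the unit revenue of a type-$k$ station and $d^{ts}_i$ is the charging demand at node $i$ in period $t$ and scenario $s$. The location variables $x^{ts}_h$ are binary, and $q^{ts}_i$ is a real variable representing revenue. Partial derivatives at points of $\{0,1\}^{|H|}$, which lie on the boundary of $[0,1]^{|H|}$, are those of the rational expression defining $Q^{ts}_i$, which is smooth wherever its denominator is positive (equivalently, the one-sided partial derivatives into the cube). *)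

theory Defs
  imports "HOL-Analysis.Analysis"
begin

text \<open>
  The finite nonempty index sets of demand nodes, periods, scenarios and location-type pairs are
  finite types; vectors indexed by the last of these are elements of \<open>real ^ 'h\<close>.
  Superscripts and subscripts become arguments in the order period, scenario, node, pair.
\<close>

definition dmax :: "('t \<Rightarrow> 's \<Rightarrow> 'i \<Rightarrow> 'h::finite \<Rightarrow> real) \<Rightarrow> 't \<Rightarrow> 's \<Rightarrow> 'i \<Rightarrow> real" where
  "dmax d t s i = Max (range (\<lambda>h. d t s i h))"

text \<open>
  The rational expression is a total function on \<open>real ^ 'h\<close>; it carries its intended meaning
  where the denominator is positive, in particular on a neighbourhood of \<open>cbox 0 1\<close>, which is
  the cube \<open>[0,1]\<^sup>H\<close>.  So partial derivatives at boundary points of the cube are ordinary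
  two-sided ones.
\<close>

definition Q :: "('i \<Rightarrow> real) \<Rightarrow> ('i \<Rightarrow> 'h::finite \<Rightarrow> real) \<Rightarrow> ('t \<Rightarrow> 's \<Rightarrow> 'i \<Rightarrow> 'h \<Rightarrow> real)
    \<Rightarrow> 't \<Rightarrow> 's \<Rightarrow> 'i \<Rightarrow> real ^ 'h \<Rightarrow> real" where
  "Q w0 w d t s i x =
    (\<Sum>h\<in>UNIV. w i h *
      ((dmax d t s i * x $ h - (dmax d t s i - d t s i h) * (x $ h)\<^sup>2)
        / (w0 i + (\<Sum>h'\<in>UNIV. w i h' * x $ h'))))"

definition partial_deriv :: "'h::finite \<Rightarrow> (real ^ 'h \<Rightarrow> real) \<Rightarrow> real ^ 'h \<Rightarrow> real" where
  "partial_deriv h f x = deriv (\<lambda>u. f (\<chi> k. if k = h then u else x $ k)) (x $ h)"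

definition binary_vecs :: "(real ^ 'h::finite) set" where
  "binary_vecs = {x. \<forall>h. x $ h \<in> {0, 1}}"

end

theory Submission
  imports Defs
begin

text \<open>
  Write \<open>D\<close> for \<open>dmax\<close>, \<open>c\<^sub>h = D - d\<^sub>h \<ge> 0\<close> and \<open>A(x) = w\<^sub>0 + \<Sum> w\<^sub>h x\<^sub>h\<close>.  Since \<open>D \<Sum> w\<^sub>h x\<^sub>h = D (A(x) - w\<^sub>0)\<close>,
  \<open>Q(x) = D - D w\<^sub>0 / A(x) - \<Sum> w\<^sub>h c\<^sub>h x\<^sub>h\<^sup>2 / A(x)\<close>.
  Each quotient \<open>y\<^sup>2 / a\<close> (with \<open>y = 1\<close> for the second term) lies above its tangents on \<open>a > 0\<close>, so
  \<open>Q\<close> lies below its tangents on the half-space \<open>A > 0\<close>, which contains the cube.  This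
  gives concavity, and on binary vectors, where \<open>x\<^sub>h\<^sup>2 = x\<^sub>h\<close> makes \<open>Q\<close> equal to the
  original ratio, it gives the tangent cuts; the cut at \<open>x\<close> itself gives the converse.
\<close>

text \<open>The gap is the perfect square \<open>a * (y / a - z / b)\<^sup>2\<close>. The left side
  is the tangent of \<open>y\<^sup>2 / a\<close> at \<open>(z, b)\<close>; its constant term
  vanishes because the function is homogeneous of degree one.\<close>

lemma square_over_linear_tangent:
  fixes a b y z :: real
  assumes "a > 0" "b > 0"
  shows "2 * z * y / b - z\<^sup>2 * a / b\<^sup>2 \<le> y\<^sup>2 / a"
proof -
  have "0 \<le> a * (y / a - z / b)\<^sup>2"
    using assms by simp
  also have "\<dots> = y\<^sup>2 / a - (2 * z * y / b - z\<^sup>2 * a / b\<^sup>2)"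
    using assms by (simp add: field_simps power2_eq_square)
  finally show ?thesis by simp
qed

text \<open>The bound is used at the convex combination \<open>z = u x + v y\<close> for both
  endpoints; the linear parts cancel because \<open>u (x - z) + v (y - z) = 0\<close>. Any family
  \<open>g\<close> of supergradients serves.\<close>

lemma concave_on_tangentI:
  fixes f :: "real ^ 'h::finite \<Rightarrow> real" and g :: "'h \<Rightarrow> real ^ 'h \<Rightarrow> real"
  assumes "convex C"
    and tangent: "\<And>y z. y \<in> C \<Longrightarrow> z \<in> C \<Longrightarrow> f y \<le> f z + (\<Sum>h\<in>UNIV. g h z * (y $ h - z $ h))"
  shows "concave_on C f"
  unfolding concave_on_iff
proof (intro conjI ballI allI impI)
  fix x y :: "real ^ 'h" and u v :: real
  assume xy: "x \<in> C" "y \<in> C" and uv: "0 \<le> u" "0 \<le> v" "u + v = 1"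
  define z where "z = u *\<^sub>R x + v *\<^sub>R y"
  define L where "L = (\<lambda>x. \<Sum>h\<in>UNIV. g h z * (x $ h - z $ h))"
  have z: "z \<in> C"
    unfolding z_def using \<open>convex C\<close> xy uv by (auto intro: convexD)
  have "u * (x $ h - z $ h) + v * (y $ h - z $ h) = 0" for h
  proof -
    have "u * (x $ h - z $ h) + v * (y $ h - z $ h)
        = (u * x $ h + v * y $ h) - (u + v) * z $ h"
      by (simp add: algebra_simps)
    then show ?thesis using uv by (simp add: z_def)
  qed
  then have "(\<Sum>h\<in>UNIV. g h z * (u * (x $ h - z $ h) + v * (y $ h - z $ h))) = 0"
    by simp
  then have L0: "u * L x + v * L y = 0"
    by (simp add: L_def sum_distrib_left flip: sum.distrib) (simp add: algebra_simps)
  have "u * f x + v * f y \<le> u * (f z + L x) + v * (f z + L y)"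
    using uv tangent[OF xy(1) z] tangent[OF xy(2) z]
    by (intro add_mono mult_left_mono) (auto simp: L_def)
  also have "\<dots> = (u + v) * f z + (u * L x + v * L y)"
    by (simp add: algebra_simps)
  finally show "u * f x + v * f y \<le> f (u *\<^sub>R x + v *\<^sub>R y)"
    using uv L0 by (simp add: z_def)
qed (rule assms(1))

definition denominator :: "('i \<Rightarrow> real) \<Rightarrow> ('i \<Rightarrow> 'h::finite \<Rightarrow> real) \<Rightarrow> 'i \<Rightarrow> real ^ 'h \<Rightarrow> real" where
  "denominator w0 w i x = w0 i + (\<Sum>h\<in>UNIV. w i h * x $ h)"

text \<open>The numerator of the gap \<open>D - Q\<close> over the common denominator
  \<open>A\<close>.\<close>

definition deficit :: "('i \<Rightarrow> real) \<Rightarrow> ('i \<Rightarrow> 'h::finite \<Rightarrow> real) \<Rightarrow> ('t \<Rightarrow> 's \<Rightarrow> 'i \<Rightarrow> 'h \<Rightarrow> real)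
    \<Rightarrow> 't \<Rightarrow> 's \<Rightarrow> 'i \<Rightarrow> real ^ 'h \<Rightarrow> real" where
  "deficit w0 w d t s i x =
    dmax d t s i * w0 i + (\<Sum>h\<in>UNIV. w i h * (dmax d t s i - d t s i h) * (x $ h)\<^sup>2)"

lemma dmax_ge: "d t s i h \<le> dmax d t s i"
  unfolding dmax_def by (rule Max_ge) auto

text \<open>As a single fraction the identity also holds where the denominator is zero, both sides
  then being 0. So it can rewrite \<open>Q\<close> under \<open>deriv\<close> without side
  conditions.\<close>

lemma Q_eq_quotient:
  "Q w0 w d t s i x
    = (dmax d t s i * denominator w0 w i x - deficit w0 w d t s i x) / denominator w0 w i x"
proof -
  have "(\<Sum>h\<in>UNIV. w i h * (dmax d t s i * x $ h - (dmax d t s i - d t s i h) * (x $ h)\<^sup>2))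
      = dmax d t s i * denominator w0 w i x - deficit w0 w d t s i x"
    by (simp add: denominator_def deficit_def sum_distrib_left algebra_simps
        flip: sum_subtractf sum.distrib)
  then show ?thesis
    by (simp add: Q_def denominator_def flip: sum_divide_distrib)
qed

text \<open>Quotient rule for \<open>D - N / A\<close>, where the h-th partial derivatives of
  \<open>A\<close> and \<open>N\<close> are \<open>w\<^sub>h\<close> and
  \<open>2 w\<^sub>h c\<^sub>h x\<^sub>h\<close>.\<close>

lemma partial_deriv_Q:
  assumes pos: "denominator w0 w i x > 0"
  shows "partial_deriv h (Q w0 w d t s i) x
    = w i h * deficit w0 w d t s i x / (denominator w0 w i x)\<^sup>2
      - 2 * w i h * (dmax d t s i - d t s i h) * x $ h / denominator w0 w i x"
proof -
  let ?D = "dmax d t s i" and ?A = "denominator w0 w i x" and ?N = "deficit w0 w d t s i x"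
  let ?c = "?D - d t s i h"
  let ?upd = "\<lambda>u. \<chi> k. if k = h then u else x $ k"
  \<comment> \<open>Only the summand of \<open>h\<close> depends on \<open>u\<close>, so along this
    coordinate \<open>A\<close> is affine and \<open>N\<close> quadratic.\<close>
  have split_sum: "(\<Sum>k\<in>UNIV. f k (?upd u $ k))
      = (\<Sum>k\<in>UNIV. f k (x $ k)) + (f h u - f h (x $ h))" for f :: "'b \<Rightarrow> real \<Rightarrow> real" and u
    by (simp add: sum.remove[of UNIV h])
  have A: "denominator w0 w i (?upd u) = ?A + w i h * (u - x $ h)" for u
    unfolding denominator_def split_sum[of "\<lambda>k v. w i k * v"] by (simp add: algebra_simps)
  have N: "deficit w0 w d t s i (?upd u) = ?N + w i h * ?c * (u\<^sup>2 - (x $ h)\<^sup>2)" for u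
    unfolding deficit_def split_sum[of "\<lambda>k v. w i k * (?D - d t s i k) * v\<^sup>2"]
    by (simp add: algebra_simps)
  have "((\<lambda>u. (?D * (?A + w i h * (u - x $ h)) - (?N + w i h * ?c * (u\<^sup>2 - (x $ h)\<^sup>2)))
        / (?A + w i h * (u - x $ h)))
      has_real_derivative w i h * ?N / ?A\<^sup>2 - 2 * w i h * ?c * x $ h / ?A) (at (x $ h))"
    using pos
    by (auto intro!: derivative_eq_intros simp: field_simps power2_eq_square)
  then show ?thesis
    unfolding partial_deriv_def Q_eq_quotient A N by (rule DERIV_imp_deriv)
qed

lemma Q_le_tangent:
  assumes w: "w0 i \<ge> 0" "\<And>h. w i h \<ge> 0" and d: "\<And>h. d t s i h \<ge> 0"
    and pos: "denominator w0 w i y > 0" "denominator w0 w i z > 0"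
  shows "Q w0 w d t s i y \<le> Q w0 w d t s i z
    + (\<Sum>h\<in>UNIV. partial_deriv h (Q w0 w d t s i) z * (y $ h - z $ h))"
proof -
  let ?D = "dmax d t s i" and ?N = "deficit w0 w d t s i"
  let ?c = "\<lambda>h. w i h * (?D - d t s i h)"
  define a where "a = denominator w0 w i y"
  define b where "b = denominator w0 w i z"
  have ab: "a > 0" "b > 0"
    using pos by (auto simp: a_def b_def)
  have D: "?D \<ge> 0"
    using d dmax_ge order_trans by metis
  have c: "?c h \<ge> 0" for h
    using w dmax_ge[of d t s i h] by simp
  have lin: "(\<Sum>h\<in>UNIV. w i h * (y $ h - z $ h)) = a - b"
    by (simp add: a_def b_def denominator_def right_diff_distrib sum_subtractf)
  \<comment> \<open>Separates the mixed terms, which occur in the tangents of the squares, from the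
    pure squares, which occur in \<open>?N z\<close>.\<close>
  have cross: "(\<Sum>h\<in>UNIV. ?c h * (2 * z $ h * (y $ h - z $ h)))
      = (\<Sum>h\<in>UNIV. ?c h * (2 * z $ h * y $ h)) - 2 * (\<Sum>h\<in>UNIV. ?c h * (z $ h)\<^sup>2)"
    by (simp add: sum_distrib_left power2_eq_square algebra_simps flip: sum_subtractf)
  have "(\<Sum>h\<in>UNIV. partial_deriv h (Q w0 w d t s i) z * (y $ h - z $ h))
      = (\<Sum>h\<in>UNIV. ?N z / b\<^sup>2 * (w i h * (y $ h - z $ h))
          - (?c h * (2 * z $ h * (y $ h - z $ h))) / b)"
    unfolding partial_deriv_Q[OF pos(2)] b_def
    by (intro sum.cong refl) (simp add: algebra_simps)
  also have "\<dots> = ?N z / b\<^sup>2 * (a - b) - (\<Sum>h\<in>UNIV. ?c h * (2 * z $ h * (y $ h - z $ h))) / b"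
    by (simp only: sum_subtractf lin flip: sum_distrib_left sum_divide_distrib)
  finally have grad: "(\<Sum>h\<in>UNIV. partial_deriv h (Q w0 w d t s i) z * (y $ h - z $ h))
      = ?N z * (a - b) / b\<^sup>2 - (\<Sum>h\<in>UNIV. ?c h * (2 * z $ h * (y $ h - z $ h))) / b"
    by simp
  \<comment> \<open>A nonnegative combination of tangent bounds. The literal ones put the constant
    term \<open>D w\<^sub>0\<close> of \<open>N\<close> into the form \<open>y\<^sup>2 / a\<close>
    with \<open>y = z = 1\<close>.\<close>
  have "?D * w0 i * (2 * 1 * 1 / b - 1\<^sup>2 * a / b\<^sup>2)
      + (\<Sum>h\<in>UNIV. ?c h * (2 * z $ h * y $ h / b - (z $ h)\<^sup>2 * a / b\<^sup>2))
      \<le> ?D * w0 i * (1\<^sup>2 / a) + (\<Sum>h\<in>UNIV. ?c h * ((y $ h)\<^sup>2 / a))"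
    using w D c
    by (intro add_mono sum_mono mult_left_mono square_over_linear_tangent ab) auto
  also have "\<dots> = ?N y / a"
    by (simp add: deficit_def add_divide_distrib sum_divide_distrib)
  also have "(\<Sum>h\<in>UNIV. ?c h * (2 * z $ h * y $ h / b - (z $ h)\<^sup>2 * a / b\<^sup>2))
      = (\<Sum>h\<in>UNIV. ?c h * (2 * z $ h * y $ h)) / b - (\<Sum>h\<in>UNIV. ?c h * (z $ h)\<^sup>2) * a / b\<^sup>2"
    by (simp add: sum_divide_distrib sum_distrib_right right_diff_distrib sum_subtractf mult.assoc)
  \<comment> \<open>The combined tangents form the tangent of \<open>N / A\<close> at
    \<open>z\<close>; the bracket is the linear term of \<open>Q\<close>, whose sign is
    opposite.\<close>
  also have "?D * w0 i * (2 * 1 * 1 / b - 1\<^sup>2 * a / b\<^sup>2) + \<dots>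
      = ?N z / b - (?N z * (a - b) / b\<^sup>2 - (\<Sum>h\<in>UNIV. ?c h * (2 * z $ h * (y $ h - z $ h))) / b)"
    using ab unfolding cross deficit_def by (simp add: field_simps power2_eq_square)
  finally have "?N z / b - (\<Sum>h\<in>UNIV. partial_deriv h (Q w0 w d t s i) z * (y $ h - z $ h))
      \<le> ?N y / a"
    unfolding grad .
  moreover have "Q w0 w d t s i y = ?D - ?N y / a" "Q w0 w d t s i z = ?D - ?N z / b"
    using ab by (simp_all add: Q_eq_quotient diff_divide_distrib flip: a_def b_def)
  ultimately show ?thesis by simp
qed

lemma Q_binary:
  assumes "x \<in> binary_vecs"
  shows "Q w0 w d t s i x
    = (\<Sum>h\<in>UNIV. d t s i h * w i h * x $ h / (w0 i + (\<Sum>h'\<in>UNIV. w i h' * x $ h')))"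
  unfolding Q_def
proof (rule sum.cong[OF refl])
  fix h
  have "x $ h = 0 \<or> x $ h = 1"
    using assms by (auto simp: binary_vecs_def)
  then show "w i h * ((dmax d t s i * x $ h - (dmax d t s i - d t s i h) * (x $ h)\<^sup>2)
        / (w0 i + (\<Sum>h'\<in>UNIV. w i h' * x $ h')))
      = d t s i h * w i h * x $ h / (w0 i + (\<Sum>h'\<in>UNIV. w i h' * x $ h'))"
    by auto
qed

lemma binary_vecs_subset_cube: "binary_vecs \<subseteq> cbox 0 1"
proof
  fix x :: "real ^ 'a"
  assume "x \<in> binary_vecs"
  then have "x $ h = 0 \<or> x $ h = 1" for h
    by (auto simp: binary_vecs_def)
  then have "0 \<le> x $ h \<and> x $ h \<le> 1" for h
    by (metis order_refl zero_le_one)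
  then show "x \<in> cbox 0 1"
    by (simp add: mem_box_cart)
qed

theorem theorem2:
  fixes w0 :: "'i::finite \<Rightarrow> real"
    and w :: "'i \<Rightarrow> 'h::finite \<Rightarrow> real"
    and d :: "'t::finite \<Rightarrow> 's::finite \<Rightarrow> 'i \<Rightarrow> 'h \<Rightarrow> real"
    and i :: 'i and t :: 't and s :: 's
  assumes "\<And>i. w0 i > 0"
    and "\<And>i h. w i h > 0"
    and "\<And>t s i h. d t s i h \<ge> 0"
  shows "concave_on (cbox 0 1) (Q w0 w d t s i) \<and>
    (\<forall>x\<in>binary_vecs. \<forall>q::real.
      q \<le> (\<Sum>h\<in>UNIV. d t s i h * w i h * x $ h / (w0 i + (\<Sum>h'\<in>UNIV. w i h' * x $ h'))) \<longleftrightarrow>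
      (\<forall>xh\<in>binary_vecs.
        q \<le> Q w0 w d t s i xh
              + (\<Sum>h\<in>UNIV. partial_deriv h (Q w0 w d t s i) xh * (x $ h - xh $ h))))"
proof -
  \<comment> \<open>On the cube the sum is nonnegative, and \<open>w0 i\<close> makes the inequality
    strict.\<close>
  have pos: "denominator w0 w i x > 0" if "x \<in> cbox 0 1" for x
    using that assms(1,2) unfolding denominator_def
    by (intro add_pos_nonneg sum_nonneg mult_nonneg_nonneg) (auto simp: mem_box_cart less_imp_le)
  have tangent: "Q w0 w d t s i y \<le> Q w0 w d t s i z
      + (\<Sum>h\<in>UNIV. partial_deriv h (Q w0 w d t s i) z * (y $ h - z $ h))"
    if "y \<in> cbox 0 1" "z \<in> cbox 0 1" for y z
    using that assms by (intro Q_le_tangent pos) (auto intro: less_imp_le)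
  have "concave_on (cbox 0 1) (Q w0 w d t s i)"
    using tangent by (rule concave_on_tangentI[OF convex_box(1)])
  \<comment> \<open>The equivalence is first shown with \<open>Q\<close> at \<open>x\<close> in
    place of the ratio; \<open>Q_binary\<close> exchanges the two at the end.\<close>
  moreover have "q \<le> Q w0 w d t s i x \<longleftrightarrow> (\<forall>xh\<in>binary_vecs.
      q \<le> Q w0 w d t s i xh
        + (\<Sum>h\<in>UNIV. partial_deriv h (Q w0 w d t s i) xh * (x $ h - xh $ h)))"
    if x: "x \<in> binary_vecs" for x and q :: real
  proof
    assume "q \<le> Q w0 w d t s i x"
    then show "\<forall>xh\<in>binary_vecs. q \<le> Q w0 w d t s i xh
        + (\<Sum>h\<in>UNIV. partial_deriv h (Q w0 w d t s i) xh * (x $ h - xh $ h))"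
      using tangent x binary_vecs_subset_cube by (meson order_trans subsetD)
  next
    assume "\<forall>xh\<in>binary_vecs. q \<le> Q w0 w d t s i xh
        + (\<Sum>h\<in>UNIV. partial_deriv h (Q w0 w d t s i) xh * (x $ h - xh $ h))"
    from bspec[OF this x] show "q \<le> Q w0 w d t s i x" by simp
  qed
  ultimately show ?thesis
    by (simp add: Q_binary)
qed

end
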